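(* In $\mathbb{R}^2$ let $\Omega_1=\partial B(0;1)$ and $\Omega_2=\partial B(0;2)$ be the circles of radius $1$ and $2$ centred at $0$, and let $\Omega=\Omega_1\cup\Omega_2$. Let $F\in\mathcal{F}^1(\Omega)$ be the 1-field with $f_x=0$ for all $x\in\Omega_1$, $f_x=1$ for all $x\in\Omega_2$, and $D_xf=0$ for all $x\in\Omega$. Let $W^+(F,\Omega)$ and $W^-(F,\Omega)$ be the 1-fields on $\mathbb{R}^2$ associated to Wells' functions $w^+(F,\Omega)$ and $w^-(F,\Omega)$. Then neither $W^+(F,\Omega)$ nor $W^-(F,\Omega)$ is an absolutely minimal Lipschitz extension of $F$ on $\mathbb{R}^2$.
   Context: $\mathbb{R}^n$ carries the standard scalar product and Euclidean norm. A 1-field on a nonempty set $\Omega\subset\mathbb{R}^n$ is a map $F$ assigning to each $x\in \Omega$ the polynomial $F(x)(a)=f_x+\langle D_xf,a-x\rangle$ ($a\in\mathbb{R}^n$), where $f_x\in\mathbb{R}$ and $D_xf\in\mathbb{R}^n$. For $x\ne y$ in $\Omega$, $\Gamma^1(F;x,y)=2\sup_{a\in\mathbb{R}^n}\frac{|F(x)(a)-F(y)(a)|}{\|x-a\|^2+\|y-a\|^2}$, and for $S\subset\Omega$, $\Gamma^1(F;S)=\sup_{x\ne y\in S}\Gamma^1(F;x,y)$. $\mathcal{F}^1(\Omega)$ is the set of 1-fields on $\Omega$ with $\Gamma^1(F;\Omega)<+\infty$. The 1-field associated to a $C^1$ function $w$ on $\mathbb{R}^n$ is $W(x)(a)=w(x)+\langle\nabla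 w(x),a-x\rangle$. For $\Omega_1\subset\Omega_2$ and $F\in\mathcal{F}^1(\Omega_1)$, $G\in\mathcal{F}^1(\Omega_2)$ is a minimal Lipschitz extension (MLE) of $F$ on $\Omega_2$ if $G(x)=F(x)$ for $x\in\Omega_1$ and $\Gamma^1(G;\Omega_2)=\Gamma^1(F;\Omega_1)$. $G$ is an absolutely minimal Lipschitz extension (AMLE) of $F$ on $\Omega_2$ if it is an MLE of $F$ on $\Omega_2$ and $\Gamma^1(G;V)=\Gamma^1(G;\partial V)$ for every nonempty bounded open $V$ with $\overline V\subset\Omega_2\setminus\Omega_1$. (In this paragraph $\Omega_1,\Omega_2$ are generic sets.) Wells' construction on a nonempty finite set $A\subset\mathbb{R}^n$, with $F\in\mathcal{F}^1(A)$, $\kappa\ge\Gamma^1(F;A)$, $\kappa>0$. For $p\in A$ set $$\widetilde p^{\pm}=p\mp D_pf/\kappa,\qquad d_p^{\pm}(x)=f_p\mp\tfrac{1}{2\kappa}\|D_pf\|^2\pm\tfrac{\kappa}{4}\|x-\widetilde p^{\pm}\|^2 .$$ For $\emptyset\neq S\subset A$ set $d_S^+(x)=\inf_{p\in S}d_p^+(x)$, $d_S^-(x)=\sup_{p\in S}d_p^-(x)$ (with $\inf\emptyset=+\infty$, $\sup\emptyset=-\infty$ when the index set $A\setminus S$ is empty); $\widetilde S^\pm=\{\widetilde p^\pm:p\in S\}$; $\widehat S^\pm$ = convex hull of $\widetilde S^\pm$; $S_H^\pm$ = smallest affine subspace containing $\widetilde S^\pm$; $S_E^\pm=\{x: d_p^\pm(x)=d_{p'}^\pm(x)\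 \forall p,p'\in S\}$; $$S_*^+=\{x:d_p^+(x)=d_{p'}^+(x)\le d_{p''}^+(x)\ \forall p,p'\in S,\ p''\in A\},$$ $$S_*^-=\{x:d_p^-(x)=d_{p'}^-(x)\ge d_{p''}^-(x)\ \forall p,p'\in S,\ p''\in A\};$$ $K^+$ = set of those $S$ for which there is $x\in S_*^+$ with $d_S^+(x)<d_{A\setminus S}^+(x)$; $K^-$ = set of those $S$ for which there is $x\in S_*^-$ with $d_S^-(x)>d_{A\setminus S}^-(x)$. For $S\in K^\pm$, $S_C^\pm=S_E^\pm\cap S_H^\pm$ is a single point, and $T_S^\pm=\{\frac12(y+z):y\in\widehat S^\pm,\ z\in S_*^\pm\}$. The sets $T_S^\pm$, $S\in K^\pm$, cover $\mathbb{R}^n$ and have pairwise disjoint interiors. With $d(x,\cdot)$ the Euclidean distance to a set, put for $x\in T_S^\pm$ $$w^\pm(F,A,\kappa)(x)=d_S^\pm(S_C^\pm)\pm\tfrac{\kappa}{2}d^2(x,S_H^\pm)\mp\tfrac{\kappa}{2}d^2(x,S_E^\pm).$$ It is known (Wells) that this is well defined on $\mathbb{R}^n$ and continuously differentiable. For a general nonempty $\Omega$, $F\in\mathcal{F}^1(\Omega)$ with $\kappa=\Gamma^1(F;\Omega)>0$, let $\mathcal{P}$ be the set of nonempty finite subsets of $\Omega$ and define, for $x\in\mathbb{R}^n$, $$w^+(F,\Omega)(x)=\inf_{P\in\mathcal{P}}w^+(F,P,\kappa)(x),\qquad w^-(F,\Omega)(x)=\sup_{P\in\mathcal{P}}w^-(F,P,\kappa)(x)$$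 ($F$ restricted to $P$). These functions are known to be continuously differentiable. *)

theory Defs
  imports "HOL-Analysis.Analysis"
begin

text \<open>
  A 1-field is a total function \<open>F\<close> with \<open>F x = (f\<^sub>x, D\<^sub>x f)\<close>; a 1-field on \<open>\<Omega>\<close> is such a function
  of which only the values at points of \<open>\<Omega>\<close> are ever used.
\<close>

type_synonym 'a one_field = "'a \<Rightarrow> real \<times> 'a"

definition field_poly :: "'a::euclidean_space one_field \<Rightarrow> 'a \<Rightarrow> 'a \<Rightarrow> real" where
  "field_poly F x a = fst (F x) + snd (F x) \<bullet> (a - x)"

text \<open>
  The suprema are taken in \<open>[0, \<infinity>]\<close>, so the constant of a 1-field on a set with at most
  one point is 0.
\<close>

definition Gamma1_pt :: "'a::euclidean_space one_field \<Rightarrow> 'a \<Rightarrow> 'a \<Rightarrow> ennreal" where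
  "Gamma1_pt F x y =
     2 * (SUP a. ennreal (\<bar>field_poly F x a - field_poly F y a\<bar> /
                          ((norm (x - a))\<^sup>2 + (norm (y - a))\<^sup>2)))"

definition Gamma1 :: "'a::euclidean_space one_field \<Rightarrow> 'a set \<Rightarrow> ennreal" where
  "Gamma1 F S = (SUP (x, y) \<in> {(x, y). x \<in> S \<and> y \<in> S \<and> x \<noteq> y}. Gamma1_pt F x y)"

definition F1 :: "'a::euclidean_space set \<Rightarrow> 'a one_field set" where
  "F1 \<Omega> = {F. Gamma1 F \<Omega> < \<infinity>}"

definition assoc_field :: "('a::euclidean_space \<Rightarrow> real) \<Rightarrow> 'a one_field" where
  "assoc_field w x = (w x, THE D. GDERIV w x :> D)"

definition is_MLE ::
  "'a::euclidean_space one_field \<Rightarrow> 'a set \<Rightarrow> 'a one_field \<Rightarrow> 'a set \<Rightarrow> bool" where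
  "is_MLE F \<Omega>1 G \<Omega>2 \<longleftrightarrow>
     G \<in> F1 \<Omega>2 \<and> (\<forall>x\<in>\<Omega>1. field_poly G x = field_poly F x) \<and> Gamma1 G \<Omega>2 = Gamma1 F \<Omega>1"

definition is_AMLE ::
  "'a::euclidean_space one_field \<Rightarrow> 'a set \<Rightarrow> 'a one_field \<Rightarrow> 'a set \<Rightarrow> bool" where
  "is_AMLE F \<Omega>1 G \<Omega>2 \<longleftrightarrow>
     is_MLE F \<Omega>1 G \<Omega>2 \<and>
     (\<forall>V. V \<noteq> {} \<and> bounded V \<and> open V \<and> closure V \<subseteq> \<Omega>2 - \<Omega>1
        \<longrightarrow> Gamma1 G V = Gamma1 G (frontier V))"

text \<open>
  Wells' construction. The parameter \<open>\<sigma>\<close> stands for the sign \<open>\<plusminus>\<close> and is only ever \<open>1\<close> or \<open>-1\<close>.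
\<close>

definition w_tilde :: "real \<Rightarrow> real \<Rightarrow> 'a::euclidean_space one_field \<Rightarrow> 'a \<Rightarrow> 'a" where
  "w_tilde \<sigma> \<kappa> F p = p - (\<sigma> / \<kappa>) *\<^sub>R snd (F p)"

definition w_d :: "real \<Rightarrow> real \<Rightarrow> 'a::euclidean_space one_field \<Rightarrow> 'a \<Rightarrow> 'a \<Rightarrow> real" where
  "w_d \<sigma> \<kappa> F p x =
     fst (F p) - \<sigma> / (2 * \<kappa>) * (norm (snd (F p)))\<^sup>2 + \<sigma> * \<kappa> / 4 * (norm (x - w_tilde \<sigma> \<kappa> F p))\<^sup>2"

text \<open>Extended reals, so that the infimum (supremum) over the empty set is \<open>\<infinity>\<close> (\<open>-\<infinity>\<close>).\<close>

definition w_dS_plus :: "real \<Rightarrow> 'a::euclidean_space one_field \<Rightarrow> 'a set \<Rightarrow> 'a \<Rightarrow> ereal" where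
  "w_dS_plus \<kappa> F S x = (INF p\<in>S. ereal (w_d 1 \<kappa> F p x))"

definition w_dS_minus :: "real \<Rightarrow> 'a::euclidean_space one_field \<Rightarrow> 'a set \<Rightarrow> 'a \<Rightarrow> ereal" where
  "w_dS_minus \<kappa> F S x = (SUP p\<in>S. ereal (w_d (-1) \<kappa> F p x))"

definition w_hat :: "real \<Rightarrow> real \<Rightarrow> 'a::euclidean_space one_field \<Rightarrow> 'a set \<Rightarrow> 'a set" where
  "w_hat \<sigma> \<kappa> F S = convex hull (w_tilde \<sigma> \<kappa> F ` S)"

definition w_H :: "real \<Rightarrow> real \<Rightarrow> 'a::euclidean_space one_field \<Rightarrow> 'a set \<Rightarrow> 'a set" where
  "w_H \<sigma> \<kappa> F S = affine hull (w_tilde \<sigma> \<kappa> F ` S)"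

definition w_E :: "real \<Rightarrow> real \<Rightarrow> 'a::euclidean_space one_field \<Rightarrow> 'a set \<Rightarrow> 'a set" where
  "w_E \<sigma> \<kappa> F S = {x. \<forall>p\<in>S. \<forall>p'\<in>S. w_d \<sigma> \<kappa> F p x = w_d \<sigma> \<kappa> F p' x}"

text \<open>For \<open>\<sigma> = -1\<close> the factor \<open>\<sigma>\<close> reverses the inequality.\<close>

definition w_star ::
  "real \<Rightarrow> real \<Rightarrow> 'a::euclidean_space one_field \<Rightarrow> 'a set \<Rightarrow> 'a set \<Rightarrow> 'a set" where
  "w_star \<sigma> \<kappa> F A S =
     {x. \<forall>p\<in>S. \<forall>p'\<in>S. \<forall>p''\<in>A. w_d \<sigma> \<kappa> F p x = w_d \<sigma> \<kappa> F p' x \<and>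
                                  \<sigma> * w_d \<sigma> \<kappa> F p' x \<le> \<sigma> * w_d \<sigma> \<kappa> F p'' x}"

definition w_K_plus :: "real \<Rightarrow> 'a::euclidean_space one_field \<Rightarrow> 'a set \<Rightarrow> 'a set set" where
  "w_K_plus \<kappa> F A =
     {S. S \<noteq> {} \<and> S \<subseteq> A \<and>
         (\<exists>x\<in>w_star 1 \<kappa> F A S. w_dS_plus \<kappa> F S x < w_dS_plus \<kappa> F (A - S) x)}"

definition w_K_minus :: "real \<Rightarrow> 'a::euclidean_space one_field \<Rightarrow> 'a set \<Rightarrow> 'a set set" where
  "w_K_minus \<kappa> F A =
     {S. S \<noteq> {} \<and> S \<subseteq> A \<and>
         (\<exists>x\<in>w_star (-1) \<kappa> F A S. w_dS_minus \<kappa> F S x > w_dS_minus \<kappa> F (A - S) x)}"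

definition w_C :: "real \<Rightarrow> real \<Rightarrow> 'a::euclidean_space one_field \<Rightarrow> 'a set \<Rightarrow> 'a" where
  "w_C \<sigma> \<kappa> F S = (THE c. c \<in> w_E \<sigma> \<kappa> F S \<inter> w_H \<sigma> \<kappa> F S)"

definition w_T ::
  "real \<Rightarrow> real \<Rightarrow> 'a::euclidean_space one_field \<Rightarrow> 'a set \<Rightarrow> 'a set \<Rightarrow> 'a set" where
  "w_T \<sigma> \<kappa> F A S = {(1/2) *\<^sub>R (y + z) | y z. y \<in> w_hat \<sigma> \<kappa> F S \<and> z \<in> w_star \<sigma> \<kappa> F A S}"

text \<open>
  The piecewise definitions: by Wells' theorem the cells cover the space and the value at a
  point does not depend on the cell chosen, so the value described is unique
  (for finite nonempty \<open>A\<close>, \<open>\<kappa> > 0\<close> and \<open>Gamma1 F A \<le> \<kappa>\<close>).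
\<close>

definition wells_plus ::
  "'a::euclidean_space one_field \<Rightarrow> 'a set \<Rightarrow> real \<Rightarrow> 'a \<Rightarrow> real" where
  "wells_plus F A \<kappa> x =
     (THE v. \<exists>S\<in>w_K_plus \<kappa> F A. x \<in> w_T 1 \<kappa> F A S \<and>
        v = real_of_ereal (w_dS_plus \<kappa> F S (w_C 1 \<kappa> F S))
            + \<kappa> / 2 * (infdist x (w_H 1 \<kappa> F S))\<^sup>2 - \<kappa> / 2 * (infdist x (w_E 1 \<kappa> F S))\<^sup>2)"

definition wells_minus ::
  "'a::euclidean_space one_field \<Rightarrow> 'a set \<Rightarrow> real \<Rightarrow> 'a \<Rightarrow> real" where
  "wells_minus F A \<kappa> x =
     (THE v. \<exists>S\<in>w_K_minus \<kappa> F A. x \<in> w_T (-1) \<kappa> F A S \<and>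
        v = real_of_ereal (w_dS_minus \<kappa> F S (w_C (-1) \<kappa> F S))
            - \<kappa> / 2 * (infdist x (w_H (-1) \<kappa> F S))\<^sup>2 + \<kappa> / 2 * (infdist x (w_E (-1) \<kappa> F S))\<^sup>2)"

definition wells_plus_gen :: "'a::euclidean_space one_field \<Rightarrow> 'a set \<Rightarrow> 'a \<Rightarrow> real" where
  "wells_plus_gen F \<Omega> x =
     (INF P \<in> {P. P \<noteq> {} \<and> finite P \<and> P \<subseteq> \<Omega>}. wells_plus F P (enn2real (Gamma1 F \<Omega>)) x)"

definition wells_minus_gen :: "'a::euclidean_space one_field \<Rightarrow> 'a set \<Rightarrow> 'a \<Rightarrow> real" where
  "wells_minus_gen F \<Omega> x =
     (SUP P \<in> {P. P \<noteq> {} \<and> finite P \<and> P \<subseteq> \<Omega>}. wells_minus F P (enn2real (Gamma1 F \<Omega>)) x)"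

end

theory Submission
  imports Defs
begin

text \<open>
  For a finite set \<open>A\<close>, Wells' upper function has the closed form
  \<open>w\<^sup>+(x) = max\<^sub>z (min\<^sub>p d\<^sub>p\<^sup>+(z) - \<kappa> / 2 * \<parallel>x - z\<parallel>\<^sup>2)\<close>, where \<open>p\<close> ranges over \<open>A\<close>.
  The cells of Wells are the first-order optimality conditions of this concave maximization: a point
  \<open>x = (y + z) / 2\<close> of the cell of \<open>S\<close> has \<open>z\<close> as maximizer and \<open>S\<close> contains only pieces active at
  \<open>z\<close> (\<open>wells_cell_value\<close>, \<open>wells_env_max_at_cell\<close>, \<open>wells_cells_cover\<close>). This shows that the
  piecewise definition determines a value (\<open>wells_plus_eq_max\<close>), and two properties follow at once:
  choosing \<open>z = x\<close> gives \<open>w\<^sup>+ \<ge> min d\<^sub>p\<^sup>+\<close> (\<open>wells_inf_ge\<close>), and the construction commutes with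
  rotations (\<open>wells_inf_radial\<close>). Negating the field exchanges \<open>w\<^sup>+\<close> and \<open>- w\<^sup>-\<close>
  (\<open>wells_minus_eq\<close>), so both functions are treated together.

  For the two circles \<open>w\<^sup>+\<close> and \<open>w\<^sup>-\<close> are thus radial, with absolute value at least \<open>\<kappa> / 4\<close> at the
  centre, where \<open>\<kappa> \<ge> 4\<close> is the constant of \<open>F\<close>. Suppose that one of them gives an absolutely minimal
  extension \<open>G\<close>. The field vanishes with its gradient on the unit circle, so on the circle of radius
  \<open>r < 1\<close> the gradient has norm at most \<open>3 \<kappa> (1 - r)\<close>. As \<open>G\<close> is radial, it coincides on that
  circle with the field of a quadratic \<open>c + m \<parallel>x\<parallel>\<^sup>2 / 2\<close> with \<open>\<bar>m\<bar> \<le> 3 \<kappa> (1 - r) / r\<close>, and its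
  constant there is at most \<open>\<bar>m\<bar>\<close>. Absolute minimality transfers this bound to the whole disc, which
  for \<open>r = 9/10\<close> makes \<open>G\<close> too flat to reach \<open>\<kappa> / 4\<close> at the centre (\<open>radial_field_not_AMLE\<close>).
\<close>

section \<open>Orthogonal projection onto affine subspaces\<close>

lemma ex_projection_affine:
  fixes S :: "'a::euclidean_space set"
  assumes "affine S" "S \<noteq> {}"
  obtains c where "c \<in> S" "\<And>h. h \<in> S \<Longrightarrow> (z - c) \<bullet> (h - c) = 0"
proof -
  define c where "c = closest_point S z"
  have cl: "closed S" "convex S"
    using assms affine_closed affine_imp_convex by auto
  have c: "c \<in> S"
    using cl assms closest_point_in_set by (auto simp: c_def)
  have le: "(z - c) \<bullet> (h - c) \<le> 0" if "h \<in> S" for h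
    using closest_point_dot[OF cl(2,1) that] by (simp add: c_def)
  have "(z - c) \<bullet> (h - c) = 0" if h: "h \<in> S" for h
  proof -
    \<comment> \<open>Reflecting \<open>h\<close> in \<open>c\<close> gives the opposite inequality.\<close>
    have "2 *\<^sub>R c + (-1) *\<^sub>R h \<in> S"
      using assms(1) c h unfolding affine_def
      by (metis add_uminus_conv_diff diff_add_cancel numeral_Bit0 numeral_One one_add_one)
    from le[OF this] have "0 \<le> (z - c) \<bullet> (h - c)"
      by (simp add: scaleR_2 inner_diff_right inner_add_right)
    with le[OF h] show ?thesis by simp
  qed
  with c that show ?thesis by blast
qed

lemma infdist_eq_norm_of_orthogonal:
  fixes S :: "'a::euclidean_space set"
  assumes "a \<in> S" "\<And>h. h \<in> S \<Longrightarrow> (x - a) \<bullet> (h - a) = 0"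
  shows "infdist x S = norm (x - a)"
proof (rule antisym)
  show "infdist x S \<le> norm (x - a)"
    using infdist_le[OF assms(1), of x] by (simp add: dist_norm)
  have "norm (x - a) \<le> dist x h" if "h \<in> S" for h
  proof -
    have "(norm (x - h))\<^sup>2 = (norm (x - a))\<^sup>2 + (norm (h - a))\<^sup>2"
      using assms(2)[OF that]
      by (simp add: power2_norm_eq_inner inner_diff_left inner_diff_right inner_commute)
    then have "(norm (x - a))\<^sup>2 \<le> (norm (x - h))\<^sup>2" by simp
    then show ?thesis by (simp add: dist_norm)
  qed
  moreover have "S \<noteq> {}" using assms(1) by blast
  ultimately show "norm (x - a) \<le> infdist x S"
    unfolding infdist_def by (auto intro: cINF_greatest)
qed

section \<open>The value of Wells' function on a cell\<close>

text \<open>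
  All the functions \<open>d\<^sub>p\<^sup>+\<close> have the same quadratic part. The change of \<open>d\<^sub>p\<^sup>+\<close> between two points
  therefore depends on \<open>p\<close> only through a linear function of the shifted point, which is why
  equality sets are affine and why convex hulls of shifted points enter.
\<close>

lemma w_d_diff:
  "w_d 1 \<kappa> F p z' - w_d 1 \<kappa> F p z =
     \<kappa> / 4 * (z' \<bullet> z' - z \<bullet> z - 2 * ((z' - z) \<bullet> w_tilde 1 \<kappa> F p))"
proof -
  have "(norm (z' - q))\<^sup>2 - (norm (z - q))\<^sup>2 = z' \<bullet> z' - z \<bullet> z - 2 * ((z' - z) \<bullet> q)" for q
    unfolding power2_norm_eq_inner
    by (simp add: inner_diff_left inner_diff_right inner_commute)
  then show ?thesis
    by (simp add: w_d_def flip: right_diff_distrib)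
qed

lemma w_E_iff:
  assumes "\<kappa> > 0" "z \<in> w_E 1 \<kappa> F S"
  shows "x \<in> w_E 1 \<kappa> F S \<longleftrightarrow>
    (\<forall>p\<in>S. \<forall>p'\<in>S. (x - z) \<bullet> (w_tilde 1 \<kappa> F p - w_tilde 1 \<kappa> F p') = 0)"
proof -
  have "w_d 1 \<kappa> F p x = w_d 1 \<kappa> F p' x \<longleftrightarrow>
      (x - z) \<bullet> (w_tilde 1 \<kappa> F p - w_tilde 1 \<kappa> F p') = 0" if "p \<in> S" "p' \<in> S" for p p'
  proof -
    have "w_d 1 \<kappa> F p z = w_d 1 \<kappa> F p' z" using assms(2) that unfolding w_E_def by blast
    then have "w_d 1 \<kappa> F p x - w_d 1 \<kappa> F p' x =
        (w_d 1 \<kappa> F p x - w_d 1 \<kappa> F p z) - (w_d 1 \<kappa> F p' x - w_d 1 \<kappa> F p' z)"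
      by linarith
    also have "\<dots> = - (\<kappa> / 2) * ((x - z) \<bullet> (w_tilde 1 \<kappa> F p - w_tilde 1 \<kappa> F p'))"
    proof -
      have "k / 4 * (n - 2 * a) - k / 4 * (n - 2 * b) = - (k / 2) * (a - b)" for k n a b :: real
        by (simp add: algebra_simps) argo
      then show ?thesis
        unfolding w_d_diff inner_diff_right[of "x - z" "w_tilde 1 \<kappa> F p"] by blast
    qed
    finally have "w_d 1 \<kappa> F p x = w_d 1 \<kappa> F p' x \<longleftrightarrow>
        - (\<kappa> / 2) * ((x - z) \<bullet> (w_tilde 1 \<kappa> F p - w_tilde 1 \<kappa> F p')) = 0"
      by linarith
    then show ?thesis using assms(1) by auto
  qed
  then show ?thesis unfolding w_E_def by blast
qed

text \<open>
  Orthogonality to all differences of points of \<open>T\<close> is what membership in \<open>S\<^sub>E\<close> provides;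
  this carries it over from the shifted points to the affine subspace \<open>S\<^sub>H\<close>.
\<close>

lemma inner_affine_hull_const:
  fixes u :: "'a::euclidean_space"
  assumes "\<And>p p'. p \<in> T \<Longrightarrow> p' \<in> T \<Longrightarrow> u \<bullet> (p - p') = 0"
    and "h \<in> affine hull T" "h' \<in> affine hull T"
  shows "u \<bullet> (h - h') = 0"
proof -
  from assms(2) obtain t where t: "t \<in> T" using affine_hull_eq_empty by blast
  have "affine hull T \<subseteq> {x. u \<bullet> x = u \<bullet> t}"
    using assms(1)[OF _ t] by (intro hull_minimal affine_hyperplane) (auto simp: inner_diff_right)
  with assms(2,3) have "u \<bullet> h = u \<bullet> t" "u \<bullet> h' = u \<bullet> t" by auto
  then show ?thesis by (simp add: inner_diff_right)
qed

text \<open>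
  The value that Wells' formula for the upper function prescribes on the cell of \<open>S\<close>, named so that
  it can be discussed before it is known that overlapping cells agree.
\<close>

definition wells_cell_fun ::
  "real \<Rightarrow> 'a::euclidean_space one_field \<Rightarrow> 'a set \<Rightarrow> 'a \<Rightarrow> real" where
  "wells_cell_fun \<kappa> F S x = real_of_ereal (w_dS_plus \<kappa> F S (w_C 1 \<kappa> F S))
     + \<kappa> / 2 * (infdist x (w_H 1 \<kappa> F S))\<^sup>2 - \<kappa> / 2 * (infdist x (w_E 1 \<kappa> F S))\<^sup>2"

text \<open>
  The subspaces \<open>S\<^sub>H\<close> and \<open>S\<^sub>E\<close> are orthogonal and meet in \<open>c = S\<^sub>C\<close>, the projection of \<open>z\<close> onto
  \<open>S\<^sub>H\<close>. For the midpoint \<open>x\<close> of \<open>y\<close> and \<open>z\<close> the nearest points in \<open>S\<^sub>H\<close> and \<open>S\<^sub>E\<close> are the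
  midpoints of \<open>c, y\<close> and of \<open>c, z\<close>, so both distances are half the lengths of the legs of a right
  triangle with hypotenuse from \<open>y\<close> to \<open>z\<close>. Pythagoras then removes \<open>c\<close> from the formula.
\<close>

lemma wells_cell_value:
  fixes F :: "'a::euclidean_space one_field"
  assumes "\<kappa> > 0" and z: "z \<in> w_E 1 \<kappa> F S" and y: "y \<in> w_hat 1 \<kappa> F S"
    and x: "x = (1/2) *\<^sub>R (y + z)" and p: "p \<in> S"
  shows "wells_cell_fun \<kappa> F S x = w_d 1 \<kappa> F p z - \<kappa> / 2 * (norm (x - z))\<^sup>2"
proof -
  let ?q = "w_tilde 1 \<kappa> F" and ?H = "w_H 1 \<kappa> F S" and ?E = "w_E 1 \<kappa> F S"
  have aff: "affine ?H" and ne: "?H \<noteq> {}"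
    using p by (auto simp: w_H_def)
  obtain c where cH: "c \<in> ?H" and c: "\<And>h. h \<in> ?H \<Longrightarrow> (z - c) \<bullet> (h - c) = 0"
    using ex_projection_affine[OF aff ne] by blast
  have qH: "?q p' \<in> ?H" if "p' \<in> S" for p'
    using that by (auto simp: w_H_def intro: hull_inc)
  have yH: "y \<in> ?H"
    using y convex_hull_subset_affine_hull by (auto simp: w_hat_def w_H_def)
  have orth: "(e - e') \<bullet> (h - h') = 0"
    if "e \<in> ?E" "e' \<in> ?E" "h \<in> ?H" "h' \<in> ?H" for e e' h h'
  proof (rule inner_affine_hull_const[of "?q ` S"])
    have "\<forall>p\<in>S. \<forall>p'\<in>S. (e - e') \<bullet> (?q p - ?q p') = 0"
      using w_E_iff[OF assms(1) that(2)] that(1) by simp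
    then show "(e - e') \<bullet> (u - v) = 0" if "u \<in> ?q ` S" "v \<in> ?q ` S" for u v
      using that by auto
  qed (use that in \<open>auto simp: w_H_def\<close>)
  have cE: "c \<in> ?E"
    unfolding w_E_iff[OF assms(1) z]
  proof (intro ballI)
    fix p1 p2 assume "p1 \<in> S" "p2 \<in> S"
    then have "(z - c) \<bullet> (?q p1 - c) = 0" "(z - c) \<bullet> (?q p2 - c) = 0"
      using c qH by auto
    then show "(c - z) \<bullet> (?q p1 - ?q p2) = 0"
      by (simp add: algebra_simps)
  qed
  have C: "w_C 1 \<kappa> F S = c"
    unfolding w_C_def
  proof (rule the_equality)
    fix c' assume "c' \<in> ?E \<inter> ?H"
    then have "(c' - c) \<bullet> (c' - c) = 0" using orth cE cH by blast
    then show "c' = c" by simp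
  qed (use cE cH in auto)
  have d: "real_of_ereal (w_dS_plus \<kappa> F S c) = w_d 1 \<kappa> F p c"
  proof -
    have eq: "w_d 1 \<kappa> F p' c = w_d 1 \<kappa> F p c" if "p' \<in> S" for p'
      using cE p that unfolding w_E_def by blast
    have "(\<lambda>p'. ereal (w_d 1 \<kappa> F p' c)) ` S = (\<lambda>p'. ereal (w_d 1 \<kappa> F p c)) ` S"
      by (intro image_cong refl arg_cong[of _ _ ereal] eq)
    also have "\<dots> = {ereal (w_d 1 \<kappa> F p c)}" using p by blast
    finally have "w_dS_plus \<kappa> F S c = ereal (w_d 1 \<kappa> F p c)"
      by (simp add: w_dS_plus_def)
    then show ?thesis by simp
  qed
  define a where "a = (1/2) *\<^sub>R (c + y)"
  define b where "b = (1/2) *\<^sub>R (c + z)"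
  have "(1/2) *\<^sub>R c + (1/2) *\<^sub>R y \<in> ?H"
    using aff cH yH unfolding affine_def by (metis field_sum_of_halves)
  then have aH: "a \<in> ?H" by (simp add: a_def scaleR_right_distrib)
  have xa: "x - a = (1/2) *\<^sub>R (z - c)" and xb: "x - b = (1/2) *\<^sub>R (y - c)"
    by (simp_all add: x a_def b_def algebra_simps)
  have H: "infdist x ?H = norm (x - a)"
    by (rule infdist_eq_norm_of_orthogonal[OF aH]) (use orth[OF z cE _ aH] in \<open>simp add: xa\<close>)
  have bE: "b \<in> ?E"
    unfolding w_E_iff[OF assms(1) z]
  proof (intro ballI)
    fix p1 p2 assume "p1 \<in> S" "p2 \<in> S"
    then have "(c - z) \<bullet> (?q p1 - ?q p2) = 0"
      using orth cE z qH by blast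
    moreover have "b - z = (1/2) *\<^sub>R (c - z)" by (simp add: b_def algebra_simps flip: scaleR_2)
    ultimately show "(b - z) \<bullet> (?q p1 - ?q p2) = 0" by simp
  qed
  have E: "infdist x ?E = norm (x - b)"
    by (rule infdist_eq_norm_of_orthogonal[OF bE])
      (use orth[OF _ bE yH cH] in \<open>simp add: xb inner_commute\<close>)
  have xz: "x - z = (1/2) *\<^sub>R (y - z)" by (simp add: x algebra_simps flip: scaleR_2)
  have dz: "w_d 1 \<kappa> F p z - w_d 1 \<kappa> F p c = \<kappa> / 4 * ((z - c) \<bullet> (z - c))"
  proof -
    have "z \<bullet> z - c \<bullet> c - 2 * ((z - c) \<bullet> ?q p) = (z - c) \<bullet> (z - c) - 2 * ((z - c) \<bullet> (?q p - c))"
      by (simp add: algebra_simps inner_commute)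
    then show ?thesis using w_d_diff[of \<kappa> F p z c] c[OF qH[OF p]] by simp
  qed
  have yz: "(y - z) \<bullet> (y - z) = (y - c) \<bullet> (y - c) + (z - c) \<bullet> (z - c)"
    using c[OF yH] by (simp add: algebra_simps inner_commute)
  have half: "(norm ((1/2) *\<^sub>R v))\<^sup>2 = v \<bullet> v / 4" for v :: 'a
    unfolding power2_norm_eq_inner by simp
  show ?thesis
    unfolding wells_cell_fun_def C d H E xa xb xz half yz
    using dz by (simp add: distrib_left add_divide_distrib)
qed

section \<open>Wells' function of a finite set as a maximum\<close>

text \<open>
  For \<open>\<kappa> > 0\<close> this is, as a function of \<open>z\<close>, a minimum of quadratics with Hessian \<open>- \<kappa> / 2\<close>, hence strictly
  concave. Its maximum over \<open>z\<close> turns out to be the value of Wells' function at \<open>x\<close>.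
\<close>

definition wells_env ::
  "real \<Rightarrow> 'a::euclidean_space one_field \<Rightarrow> 'a set \<Rightarrow> 'a \<Rightarrow> 'a \<Rightarrow> real" where
  "wells_env \<kappa> F A x z = Min ((\<lambda>p. w_d 1 \<kappa> F p z) ` A) - \<kappa> / 2 * (norm (x - z))\<^sup>2"

lemma wells_env_le:
  assumes "finite A" "p \<in> A"
  shows "wells_env \<kappa> F A x z \<le> w_d 1 \<kappa> F p z - \<kappa> / 2 * (norm (x - z))\<^sup>2"
  using assms by (auto simp: wells_env_def)

text \<open>
  The slope at \<open>z\<close> is a multiple of \<open>(2 x - z) - w_tilde 1 \<kappa> F p\<close>. So \<open>z\<close> is critical for a mixture
  of the pieces exactly if \<open>2 x - z\<close> is the same mixture of the shifted points.
\<close>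

lemma penalized_w_d_diff:
  "(w_d 1 \<kappa> F p z' - \<kappa> / 2 * (norm (x - z'))\<^sup>2) - (w_d 1 \<kappa> F p z - \<kappa> / 2 * (norm (x - z))\<^sup>2) =
     \<kappa> / 2 * ((z' - z) \<bullet> (2 *\<^sub>R x - z - w_tilde 1 \<kappa> F p)) - \<kappa> / 4 * (norm (z' - z))\<^sup>2"
proof -
  let ?q = "w_tilde 1 \<kappa> F p"
  have "(w_d 1 \<kappa> F p z' - \<kappa> / 2 * (norm (x - z'))\<^sup>2) - (w_d 1 \<kappa> F p z - \<kappa> / 2 * (norm (x - z))\<^sup>2)
      = \<kappa> / 4 * (z' \<bullet> z' - z \<bullet> z - 2 * ((z' - z) \<bullet> ?q)
          - 2 * ((norm (x - z'))\<^sup>2 - (norm (x - z))\<^sup>2))"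
    using w_d_diff[of \<kappa> F p z' z] by (simp add: right_diff_distrib)
  also have "z' \<bullet> z' - z \<bullet> z - 2 * ((z' - z) \<bullet> ?q) - 2 * ((norm (x - z'))\<^sup>2 - (norm (x - z))\<^sup>2)
      = 2 * ((z' - z) \<bullet> (2 *\<^sub>R x - z - ?q)) - (norm (z' - z))\<^sup>2"
    unfolding power2_norm_eq_inner
    by (simp add: inner_diff_left inner_diff_right inner_commute)
  finally show ?thesis by (simp add: right_diff_distrib)
qed

lemma ex_inner_ge_convex_hull:
  fixes y :: "'a::euclidean_space"
  assumes "y \<in> convex hull T"
  shows "\<exists>t\<in>T. u \<bullet> y \<le> u \<bullet> t"
proof (rule ccontr)
  assume "\<not> ?thesis"
  then have "convex hull T \<subseteq> {v. u \<bullet> v < u \<bullet> y}"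
    by (intro hull_minimal convex_halfspace_lt) auto
  with assms show False by auto
qed

text \<open>
  If \<open>x\<close> is the midpoint of \<open>y\<close> and \<open>z\<close> as in the definition of the cell of \<open>S\<close>, then
  \<open>2 x - z = y\<close> lies in the hull of the shifted points. Hence in every direction from \<open>z\<close> at least
  one of the active pieces does not increase: this is the first-order condition for the concave
  function \<open>wells_env\<close>, so \<open>z\<close> is a global maximum.
\<close>

lemma wells_env_max_at_cell:
  assumes "\<kappa> > 0" "finite A" "S \<subseteq> A" "S \<noteq> {}"
    and z: "z \<in> w_star 1 \<kappa> F A S" and y: "y \<in> w_hat 1 \<kappa> F S"
    and x: "x = (1/2) *\<^sub>R (y + z)"
  shows "wells_env \<kappa> F A x z' \<le> wells_env \<kappa> F A x z"
    and "p \<in> S \<Longrightarrow> wells_env \<kappa> F A x z = w_d 1 \<kappa> F p z - \<kappa> / 2 * (norm (x - z))\<^sup>2"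
proof -
  show eq: "wells_env \<kappa> F A x z = w_d 1 \<kappa> F p z - \<kappa> / 2 * (norm (x - z))\<^sup>2" if "p \<in> S" for p
  proof -
    have "Min ((\<lambda>p. w_d 1 \<kappa> F p z) ` A) = w_d 1 \<kappa> F p z"
      using that assms(2,3) z by (intro Min_eqI) (auto simp: w_star_def)
    then show ?thesis by (simp add: wells_env_def)
  qed
  obtain p where p: "p \<in> S" and py: "(z' - z) \<bullet> y \<le> (z' - z) \<bullet> w_tilde 1 \<kappa> F p"
    using ex_inner_ge_convex_hull y unfolding w_hat_def by blast
  have "2 *\<^sub>R x - z = y" by (simp add: x)
  then have "\<kappa> / 2 * ((z' - z) \<bullet> (2 *\<^sub>R x - z - w_tilde 1 \<kappa> F p)) \<le> 0"
    using py assms(1) by (simp add: inner_diff_right mult_le_0_iff)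
  moreover have "0 \<le> \<kappa> / 4 * (norm (z' - z))\<^sup>2" using assms(1) by simp
  ultimately have "w_d 1 \<kappa> F p z' - \<kappa> / 2 * (norm (x - z'))\<^sup>2
      \<le> w_d 1 \<kappa> F p z - \<kappa> / 2 * (norm (x - z))\<^sup>2"
    using penalized_w_d_diff[of \<kappa> F p z' x z] by linarith
  then show "wells_env \<kappa> F A x z' \<le> wells_env \<kappa> F A x z"
    using wells_env_le[of A p \<kappa> F x z'] p assms(2,3) eq[OF p] by auto
qed

lemma continuous_on_Min_image:
  fixes f :: "'i \<Rightarrow> 'a::topological_space \<Rightarrow> real"
  assumes "finite A" "A \<noteq> {}" "\<And>p. p \<in> A \<Longrightarrow> continuous_on X (f p)"
  shows "continuous_on X (\<lambda>z. Min ((\<lambda>p. f p z) ` A))"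
  using assms
proof (induction A rule: finite_ne_induct)
  case (insert a A)
  then show ?case by (auto simp: intro!: continuous_intros)
qed auto

lemma continuous_on_w_d: "continuous_on X (w_d \<sigma> \<kappa> F p)"
  unfolding w_d_def by (intro continuous_intros)

text \<open>
  A single piece already is a downward paraboloid with vertex \<open>m\<close>, so outside a ball around \<open>m\<close> the
  function stays below its value at \<open>m\<close>.
\<close>

lemma wells_env_attains_max:
  fixes F :: "'a::euclidean_space one_field"
  assumes "\<kappa> > 0" "finite A" "A \<noteq> {}"
  obtains z where "\<And>z'. wells_env \<kappa> F A x z' \<le> wells_env \<kappa> F A x z"
proof -
  obtain p where p: "p \<in> A" using assms by blast
  define m where "m = 2 *\<^sub>R x - w_tilde 1 \<kappa> F p"
  define g where "g z = w_d 1 \<kappa> F p z - \<kappa> / 2 * (norm (x - z))\<^sup>2" for z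
  have g: "g z = g m - \<kappa> / 4 * (norm (z - m))\<^sup>2" for z
    using penalized_w_d_diff[of \<kappa> F p z x m] by (simp add: g_def m_def)
  \<comment> \<open>Beyond this radius \<open>g\<close> is below the value of the whole minimum at \<open>m\<close>.\<close>
  define R where "R = sqrt (4 / \<kappa> * (g m - wells_env \<kappa> F A x m))"
  have far: "wells_env \<kappa> F A x z < wells_env \<kappa> F A x m" if "z \<notin> cball m R" for z
  proof (rule ccontr)
    assume "\<not> ?thesis"
    then have "wells_env \<kappa> F A x m \<le> g m - \<kappa> / 4 * (norm (z - m))\<^sup>2"
      using wells_env_le[OF assms(2) p, of \<kappa> F x z] g[of z] by (simp add: g_def)
    then have "(norm (z - m))\<^sup>2 \<le> 4 / \<kappa> * (g m - wells_env \<kappa> F A x m)"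
      using assms(1) by (simp add: field_simps)
    then have "norm (z - m) \<le> R" unfolding R_def using real_le_rsqrt by blast
    with that show False by (simp add: dist_norm norm_minus_commute)
  qed
  have "R \<ge> 0" unfolding R_def
    using wells_env_le[OF assms(2) p, of \<kappa> F x m] assms(1) by (simp add: g_def)
  then have "cball m R \<noteq> {}" by auto
  moreover have "continuous_on (cball m R) (wells_env \<kappa> F A x)"
    unfolding wells_env_def
    by (intro continuous_intros continuous_on_Min_image assms continuous_on_w_d)
  ultimately obtain z where z: "z \<in> cball m R"
      "\<And>z'. z' \<in> cball m R \<Longrightarrow> wells_env \<kappa> F A x z' \<le> wells_env \<kappa> F A x z"
    using continuous_attains_sup[of "cball m R" "wells_env \<kappa> F A x"] by auto
  have "wells_env \<kappa> F A x z' \<le> wells_env \<kappa> F A x z" for z'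
    using z(2)[of z'] far[of z'] z(2)[of m] \<open>R \<ge> 0\<close> by (cases "z' \<in> cball m R") auto
  then show ?thesis by (rule that)
qed

text \<open>
  The converse first-order condition. Take a maximum \<open>z\<close> and let \<open>S\<close> consist of the active pieces.
  If \<open>2 x - z\<close> were outside the hull of the shifted points of \<open>S\<close>, then moving \<open>z\<close> against the
  normal of a separating hyperplane would increase all active pieces, while the others stay above for
  a short while. So \<open>2 x - z\<close> is in the hull and \<open>x\<close> is in the cell of \<open>S\<close>.
\<close>

lemma wells_cells_cover:
  fixes F :: "'a::euclidean_space one_field"
  assumes "\<kappa> > 0" "finite A" "A \<noteq> {}"
  obtains S where "S \<in> w_K_plus \<kappa> F A" "x \<in> w_T 1 \<kappa> F A S"
proof -
  obtain z where z: "\<And>z'. wells_env \<kappa> F A x z' \<le> wells_env \<kappa> F A x z"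
    using wells_env_attains_max[OF assms] by blast
  define m where "m = Min ((\<lambda>p. w_d 1 \<kappa> F p z) ` A)"
  define S where "S = {p \<in> A. w_d 1 \<kappa> F p z = m}"
  define y where "y = 2 *\<^sub>R x - z"
  let ?q = "w_tilde 1 \<kappa> F"
  have finS: "finite S" and SA: "S \<subseteq> A" using assms by (auto simp: S_def)
  have "m \<in> (\<lambda>p. w_d 1 \<kappa> F p z) ` A" unfolding m_def using assms by (intro Min_in) auto
  then have Sne: "S \<noteq> {}" by (auto simp: S_def)
  have mle: "m \<le> w_d 1 \<kappa> F p z" if "p \<in> A" for p using that assms by (auto simp: m_def)
  have star: "z \<in> w_star 1 \<kappa> F A S"
    using mle by (auto simp: w_star_def S_def)
  have gap: "m < w_d 1 \<kappa> F p z" if "p \<in> A - S" for p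
    using mle[of p] that by (auto simp: S_def)
  have K: "S \<in> w_K_plus \<kappa> F A"
  proof -
    have "(\<lambda>p. ereal (w_d 1 \<kappa> F p z)) ` S = {ereal m}"
      using Sne by (auto simp: S_def image_iff)
    then have "w_dS_plus \<kappa> F S z = ereal m"
      by (simp add: w_dS_plus_def)
    also have "\<dots> < w_dS_plus \<kappa> F (A - S) z"
    proof (cases "A - S = {}")
      case True
      show ?thesis unfolding w_dS_plus_def True by (simp add: top_ereal_def)
    next
      case False
      then show ?thesis
        unfolding w_dS_plus_def using assms gap by (subst finite_less_Inf_iff) auto
    qed
    finally show ?thesis using star Sne SA by (auto simp: w_K_plus_def)
  qed
  have "y \<in> w_hat 1 \<kappa> F S"
  proof (rule ccontr)
    assume "y \<notin> w_hat 1 \<kappa> F S"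
    moreover have "closed (w_hat 1 \<kappa> F S)" "convex (w_hat 1 \<kappa> F S)"
      using finS by (auto simp: w_hat_def intro!: compact_imp_closed finite_imp_compact_convex_hull)
    ultimately obtain a b where ab: "a \<bullet> y < b" "\<And>v. v \<in> w_hat 1 \<kappa> F S \<Longrightarrow> a \<bullet> v > b"
      using separating_hyperplane_closed_point by metis
    have aq: "a \<bullet> (?q p - y) > 0" if "p \<in> S" for p
    proof -
      have "?q p \<in> w_hat 1 \<kappa> F S" using that by (auto simp: w_hat_def intro: hull_inc)
      then show ?thesis using ab by (force simp: inner_diff_right)
    qed
    \<comment> \<open>The piece of \<open>p\<close> along the ray from \<open>z\<close> against the separating normal.\<close>
    define v where "v p t = w_d 1 \<kappa> F p (z - t *\<^sub>R a) - \<kappa> / 2 * (norm (x - (z - t *\<^sub>R a)))\<^sup>2" for p t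
    have v: "v p t - v p 0 = \<kappa> / 4 * t * (2 * (a \<bullet> (?q p - y)) - t * (norm a)\<^sup>2)" for p t
      using penalized_w_d_diff[of \<kappa> F p "z - t *\<^sub>R a" x z]
      by (simp add: v_def y_def algebra_simps power2_eq_square)
    have env0: "wells_env \<kappa> F A x z = m - \<kappa> / 2 * (norm (x - z))\<^sup>2"
      by (simp add: wells_env_def m_def)
    have "\<forall>\<^sub>F t in at_right 0. wells_env \<kappa> F A x z < v p t" if "p \<in> A" for p
    proof (cases "p \<in> S")
      case True
      have "((\<lambda>t. 2 * (a \<bullet> (?q p - y)) - t * (norm a)\<^sup>2) \<longlongrightarrow>
              2 * (a \<bullet> (?q p - y)) - 0 * (norm a)\<^sup>2) (at_right 0)"
        by (intro tendsto_intros)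
      then have "\<forall>\<^sub>F t in at_right 0. 0 < 2 * (a \<bullet> (?q p - y)) - t * (norm a)\<^sup>2"
        using aq[OF True] by (intro order_tendstoD(1)[where y = "2 * (a \<bullet> (?q p - y)) - 0 * (norm a)\<^sup>2"]) auto
      moreover have "\<forall>\<^sub>F t in at_right 0. (0::real) < t"
        by (rule eventually_at_right_less)
      ultimately show ?thesis
      proof eventually_elim
        case (elim t)
        then have "0 < v p t - v p 0" using assms(1) unfolding v by auto
        then show ?case using True env0 by (simp add: v_def S_def)
      qed
    next
      case False
      have "((\<lambda>t. v p t) \<longlongrightarrow> w_d 1 \<kappa> F p (z - 0 *\<^sub>R a) - \<kappa> / 2 * (norm (x - (z - 0 *\<^sub>R a)))\<^sup>2) (at_right 0)"
        unfolding v_def w_d_def by (intro tendsto_intros)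
      then show ?thesis
        using gap[of p] False that env0 by (intro order_tendstoD(1)) auto
    qed
    then have "\<forall>\<^sub>F t in at_right 0. \<forall>p\<in>A. wells_env \<kappa> F A x z < v p t"
      using assms(2) by (intro eventually_ball_finite) auto
    then obtain t where t: "\<And>p. p \<in> A \<Longrightarrow> wells_env \<kappa> F A x z < v p t"
      using eventually_happens'[OF trivial_limit_at_right_real] by blast
    have "Min ((\<lambda>p. w_d 1 \<kappa> F p (z - t *\<^sub>R a)) ` A) \<in> (\<lambda>p. w_d 1 \<kappa> F p (z - t *\<^sub>R a)) ` A"
      using assms by (intro Min_in) auto
    then obtain p where "p \<in> A" "wells_env \<kappa> F A x (z - t *\<^sub>R a) = v p t"
      by (auto simp: wells_env_def v_def)
    with t[of p] z[of "z - t *\<^sub>R a"] show False by auto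
  qed
  moreover have "x = (1/2) *\<^sub>R (y + z)" by (simp add: y_def)
  ultimately have "x \<in> w_T 1 \<kappa> F A S" using star by (auto simp: w_T_def)
  with K that show ?thesis by blast
qed

lemma wells_cell_fun_eq_max:
  fixes F :: "'a::euclidean_space one_field"
  assumes "\<kappa> > 0" "finite A" "S \<in> w_K_plus \<kappa> F A" "x \<in> w_T 1 \<kappa> F A S"
  obtains z where "wells_cell_fun \<kappa> F S x = wells_env \<kappa> F A x z"
    and "\<And>z'. wells_env \<kappa> F A x z' \<le> wells_env \<kappa> F A x z"
proof -
  have SA: "S \<subseteq> A" "S \<noteq> {}" using assms(3) by (auto simp: w_K_plus_def)
  obtain y z where yz: "y \<in> w_hat 1 \<kappa> F S" "z \<in> w_star 1 \<kappa> F A S" "x = (1/2) *\<^sub>R (y + z)"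
    using assms(4) by (auto simp: w_T_def)
  obtain p where p: "p \<in> S" using SA by blast
  have zE: "z \<in> w_E 1 \<kappa> F S" using yz(2) SA unfolding w_star_def w_E_def by blast
  have "wells_cell_fun \<kappa> F S x = wells_env \<kappa> F A x z"
    using wells_cell_value[OF assms(1) zE yz(1,3) p]
      wells_env_max_at_cell(2)[OF assms(1,2) SA yz(2,1,3) p] by simp
  then show ?thesis
    using wells_env_max_at_cell(1)[OF assms(1,2) SA yz(2,1,3)] by (rule that)
qed

text \<open>
  On every cell containing \<open>x\<close> the formula gives one and the same maximum; this is what makes the
  piecewise definition meaningful.
\<close>

lemma wells_cell_fun_unique:
  fixes F :: "'a::euclidean_space one_field"
  assumes "\<kappa> > 0" "finite A"
    and "S \<in> w_K_plus \<kappa> F A" "x \<in> w_T 1 \<kappa> F A S"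
    and "S' \<in> w_K_plus \<kappa> F A" "x \<in> w_T 1 \<kappa> F A S'"
  shows "wells_cell_fun \<kappa> F S x = wells_cell_fun \<kappa> F S' x"
proof -
  obtain z where "wells_cell_fun \<kappa> F S x = wells_env \<kappa> F A x z"
    "\<And>z'. wells_env \<kappa> F A x z' \<le> wells_env \<kappa> F A x z"
    using wells_cell_fun_eq_max[OF assms(1-4)] by blast
  moreover obtain z' where "wells_cell_fun \<kappa> F S' x = wells_env \<kappa> F A x z'"
    "\<And>z. wells_env \<kappa> F A x z \<le> wells_env \<kappa> F A x z'"
    using wells_cell_fun_eq_max[OF assms(1,2,5,6)] by blast
  ultimately show ?thesis by (simp add: order_antisym)
qed

lemma wells_plus_eq_cell_fun:
  fixes F :: "'a::euclidean_space one_field"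
  assumes "\<kappa> > 0" "finite A" "S \<in> w_K_plus \<kappa> F A" "x \<in> w_T 1 \<kappa> F A S"
  shows "wells_plus F A \<kappa> x = wells_cell_fun \<kappa> F S x"
  unfolding wells_plus_def wells_cell_fun_def[symmetric]
proof (rule the_equality)
  show "\<exists>S'\<in>w_K_plus \<kappa> F A. x \<in> w_T 1 \<kappa> F A S' \<and> wells_cell_fun \<kappa> F S x = wells_cell_fun \<kappa> F S' x"
    using assms by blast
  fix v assume "\<exists>S'\<in>w_K_plus \<kappa> F A. x \<in> w_T 1 \<kappa> F A S' \<and> v = wells_cell_fun \<kappa> F S' x"
  then show "v = wells_cell_fun \<kappa> F S x"
    using wells_cell_fun_unique[OF assms(1,2) _ _ assms(3,4)] by blast
qed

lemma wells_plus_eq_max: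
  fixes F :: "'a::euclidean_space one_field"
  assumes "\<kappa> > 0" "finite A" "A \<noteq> {}"
  obtains z where "wells_plus F A \<kappa> x = wells_env \<kappa> F A x z"
    and "\<And>z'. wells_env \<kappa> F A x z' \<le> wells_env \<kappa> F A x z"
proof -
  obtain S where S: "S \<in> w_K_plus \<kappa> F A" "x \<in> w_T 1 \<kappa> F A S"
    using wells_cells_cover[OF assms] by blast
  show ?thesis
    using wells_cell_fun_eq_max[OF assms(1,2) S] wells_plus_eq_cell_fun[OF assms(1,2) S] that by metis
qed

section \<open>Radial fields with finite Lipschitz constant\<close>

lemma one_field_inequality:
  assumes "Gamma1 G S \<le> ennreal K" "K \<ge> 0" "x \<in> S" "y \<in> S" "x \<noteq> y"
  shows "\<bar>field_poly G x a - field_poly G y a\<bar> \<le> K / 2 * ((norm (x - a))\<^sup>2 + (norm (y - a))\<^sup>2)"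
proof -
  let ?N = "(norm (x - a))\<^sup>2 + (norm (y - a))\<^sup>2"
  let ?q = "\<bar>field_poly G x a - field_poly G y a\<bar> / ?N"
  have N: "?N > 0"
    using assms(5) by (cases "x = a") (auto intro: add_pos_nonneg)
  have "ennreal (2 * ?q) = 2 * ennreal ?q" by (subst ennreal_mult) auto
  also have "\<dots> \<le> Gamma1_pt G x y"
    unfolding Gamma1_pt_def by (intro mult_left_mono SUP_upper) auto
  also have "\<dots> \<le> Gamma1 G S"
    unfolding Gamma1_def using assms(3-5) by (intro SUP_upper2[of "(x, y)"]) auto
  also note assms(1)
  finally have "2 * ?q \<le> K" using assms(2) by (simp add: ennreal_le_iff)
  with N show ?thesis by (simp add: field_simps)
qed

lemma Gamma1_leI:
  assumes "K \<ge> 0"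
    and "\<And>x y a. x \<in> S \<Longrightarrow> y \<in> S \<Longrightarrow> x \<noteq> y \<Longrightarrow>
      \<bar>field_poly G x a - field_poly G y a\<bar> \<le> K / 2 * ((norm (x - a))\<^sup>2 + (norm (y - a))\<^sup>2)"
  shows "Gamma1 G S \<le> ennreal K"
  unfolding Gamma1_def
proof (rule SUP_least, clarify)
  fix x y assume xy: "x \<in> S" "y \<in> S" "x \<noteq> y"
  have "\<bar>field_poly G x a - field_poly G y a\<bar> / ((norm (x - a))\<^sup>2 + (norm (y - a))\<^sup>2) \<le> K / 2" for a
  proof -
    have "(norm (x - a))\<^sup>2 + (norm (y - a))\<^sup>2 > 0"
      using xy(3) by (cases "x = a") (auto intro: add_pos_nonneg)
    from pos_divide_le_eq[OF this] show ?thesis using assms(2)[OF xy, of a] by blast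
  qed
  then have "Gamma1_pt G x y \<le> 2 * ennreal (K / 2)"
    unfolding Gamma1_pt_def by (intro mult_left_mono SUP_least ennreal_leI) auto
  also have "\<dots> = ennreal (2 * (K / 2))" using assms(1) by (subst ennreal_mult) auto
  finally show "Gamma1_pt G x y \<le> ennreal K" by simp
qed

text \<open>
  This takes the place of differentiation in the symmetry arguments below: the quadratic bounds that
  it is applied to come from the Taylor estimate of a field with finite constant.
\<close>

lemma zero_if_le_quadratic:
  fixes b C :: real
  assumes "\<And>t. 0 < t \<Longrightarrow> t * \<bar>b\<bar> \<le> C * t\<^sup>2"
  shows "b = 0"
proof (rule ccontr)
  assume "b \<noteq> 0"
  define t where "t = \<bar>b\<bar> / (2 * (\<bar>C\<bar> + 1))"
  have t: "t > 0" using \<open>b \<noteq> 0\<close> by (simp add: t_def)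
  from assms[OF t] have "\<bar>b\<bar> \<le> C * t" using t by (simp add: power2_eq_square)
  also have "\<dots> \<le> (\<bar>C\<bar> + 1) * t" using t by (intro mult_right_mono) auto
  also have "\<dots> = \<bar>b\<bar> / 2" by (simp add: t_def field_simps)
  finally show False using \<open>b \<noteq> 0\<close> by simp
qed

text \<open>
  Evaluating the two polynomials at the second point gives a Taylor estimate, so the second
  component of a field with finite constant behaves as a gradient of the first.
\<close>

lemma taylor_inequality:
  assumes "Gamma1 G UNIV \<le> ennreal K" "K \<ge> 0"
  shows "\<bar>fst (G x) + snd (G x) \<bullet> v - fst (G (x + v))\<bar> \<le> K / 2 * (norm v)\<^sup>2"
proof (cases "v = 0")
  case False
  then show ?thesis
    using one_field_inequality[OF assms, of x "x + v" "x + v"] by (simp add: field_poly_def)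
qed simp

text \<open>
  As \<open>v\<close> is orthogonal to \<open>x\<close>, the points \<open>x + t v\<close> and \<open>x - t v\<close> have the same norm, so
  \<open>fst \<circ> G\<close> is even along that line.
  For \<open>x = 0\<close> every \<open>v\<close> is admissible and the gradient at the centre vanishes.
\<close>

lemma radial_gradient_orthogonal:
  fixes G :: "'a::euclidean_space one_field"
  assumes G: "Gamma1 G UNIV \<le> ennreal K" "K \<ge> 0"
    and radial: "\<And>x y. norm x = norm y \<Longrightarrow> fst (G x) = fst (G y)"
    and "x \<bullet> v = 0"
  shows "snd (G x) \<bullet> v = 0"
proof (rule zero_if_le_quadratic)
  fix t :: real assume "0 < t"
  have "(norm (x + t *\<^sub>R v))\<^sup>2 = (norm (x + (-t) *\<^sub>R v))\<^sup>2"
    using assms(4) unfolding power2_norm_eq_inner by (simp add: algebra_simps inner_commute)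
  then have eq: "fst (G (x + t *\<^sub>R v)) = fst (G (x + (-t) *\<^sub>R v))"
    by (intro radial) (simp add: power2_eq_iff_nonneg)
  have b: "K / 2 * (norm (s *\<^sub>R v))\<^sup>2 = K / 2 * (norm v)\<^sup>2 * s\<^sup>2" for s :: real
    by (simp add: power_mult_distrib)
  have i: "snd (G x) \<bullet> (s *\<^sub>R v) = s * (snd (G x) \<bullet> v)" for s :: real
    by simp
  have "\<bar>t * (snd (G x) \<bullet> v)\<bar> \<le> K / 2 * (norm v)\<^sup>2 * t\<^sup>2"
    using taylor_inequality[OF G, of x "t *\<^sub>R v"] taylor_inequality[OF G, of x "(-t) *\<^sub>R v"] eq
    unfolding b i power2_minus by linarith
  then show "t * \<bar>snd (G x) \<bullet> v\<bar> \<le> K / 2 * (norm v)\<^sup>2 * t\<^sup>2"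
    using \<open>0 < t\<close> by (simp add: abs_mult)
qed

lemma radial_gradient_inner:
  fixes G :: "'a::euclidean_space one_field"
  assumes G: "Gamma1 G UNIV \<le> ennreal K" "K \<ge> 0"
    and radial: "\<And>x y. norm x = norm y \<Longrightarrow> fst (G x) = fst (G y)"
    and n: "norm x = norm y"
  shows "snd (G x) \<bullet> x = snd (G y) \<bullet> y"
proof -
  have "snd (G x) \<bullet> x - snd (G y) \<bullet> y = 0"
  proof (rule zero_if_le_quadratic)
    fix t :: real assume "0 < t"
    have "norm (x + t *\<^sub>R x) = norm ((1 + t) *\<^sub>R x)" by (simp add: scaleR_left_distrib)
    also have "\<dots> = norm ((1 + t) *\<^sub>R y)" using n by simp
    also have "\<dots> = norm (y + t *\<^sub>R y)" by (simp add: scaleR_left_distrib)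
    finally have eq: "fst (G (x + t *\<^sub>R x)) = fst (G (y + t *\<^sub>R y))" by (rule radial)
    have b: "K / 2 * (norm (t *\<^sub>R v))\<^sup>2 = K / 2 * (norm v)\<^sup>2 * t\<^sup>2" for v :: 'a
      by (simp add: power_mult_distrib)
    have i: "snd (G u) \<bullet> (t *\<^sub>R u) = t * (snd (G u) \<bullet> u)" for u
      by simp
    have "\<bar>t * (snd (G x) \<bullet> x) - t * (snd (G y) \<bullet> y)\<bar> \<le> K * (norm x)\<^sup>2 * t\<^sup>2"
      using taylor_inequality[OF G, of x "t *\<^sub>R x"] taylor_inequality[OF G, of y "t *\<^sub>R y"]
        eq radial[OF n] unfolding b i n by argo
    then show "t * \<bar>snd (G x) \<bullet> x - snd (G y) \<bullet> y\<bar> \<le> K * (norm x)\<^sup>2 * t\<^sup>2"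
      using \<open>0 < t\<close> by (simp add: abs_mult flip: right_diff_distrib)
  qed
  then show ?thesis by simp
qed

lemma radial_gradient_on_sphere:
  fixes G :: "'a::euclidean_space one_field"
  assumes G: "Gamma1 G UNIV \<le> ennreal K" "K \<ge> 0"
    and radial: "\<And>x y. norm x = norm y \<Longrightarrow> fst (G x) = fst (G y)"
  obtains m where "\<And>x. norm x = r \<Longrightarrow> snd (G x) = m *\<^sub>R x"
proof -
  have par: "snd (G x) = (snd (G x) \<bullet> x / (norm x)\<^sup>2) *\<^sub>R x" for x
  proof -
    let ?u = "snd (G x) - (snd (G x) \<bullet> x / (norm x)\<^sup>2) *\<^sub>R x"
    have xu: "x \<bullet> ?u = 0"
      by (cases "x = 0") (auto simp: inner_diff_right power2_norm_eq_inner inner_commute)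
    have "?u \<bullet> ?u = snd (G x) \<bullet> ?u - (snd (G x) \<bullet> x / (norm x)\<^sup>2) * (x \<bullet> ?u)"
      by (simp only: inner_diff_left inner_scaleR_left)
    also have "\<dots> = 0"
      using radial_gradient_orthogonal[OF G radial xu] xu by simp
    finally show ?thesis by simp
  qed
  show ?thesis
  proof (cases "\<exists>e::'a. norm e = r")
    case True
    then obtain e :: 'a where e: "norm e = r" by blast
    show ?thesis
      by (rule that[of "snd (G e) \<bullet> e / r\<^sup>2"])
        (metis par e radial_gradient_inner[OF G radial])
  next
    case False
    then show ?thesis by (intro that[of 0]) blast
  qed
qed

text \<open>
  On the sphere the field agrees, up to an additive constant, with that of the quadratic
  \<open>m / 2 * (norm x)\<^sup>2\<close>, whose gradient has Lipschitz constant \<open>\<bar>m\<bar>\<close>.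
\<close>

lemma Gamma1_radial_sphere_le:
  fixes G :: "'a::euclidean_space one_field"
  assumes radial: "\<And>x y. norm x = norm y \<Longrightarrow> fst (G x) = fst (G y)"
    and m: "\<And>x. norm x = r \<Longrightarrow> snd (G x) = m *\<^sub>R x"
  shows "Gamma1 G (sphere 0 r) \<le> ennreal \<bar>m\<bar>"
proof (rule Gamma1_leI)
  fix x y a :: 'a
  assume "x \<in> sphere 0 r" "y \<in> sphere 0 r"
  then have n: "norm x = r" "norm y = r" by auto
  then have xy: "x \<bullet> x = y \<bullet> y" by (metis power2_norm_eq_inner)
  have "field_poly G x a - field_poly G y a = m * (x \<bullet> (a - x) - y \<bullet> (a - y))"
    unfolding field_poly_def m[OF n(1)] m[OF n(2)] using radial[of x y] n
    by (simp add: algebra_simps)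
  also have "x \<bullet> (a - x) - y \<bullet> (a - y) = ((norm (y - a))\<^sup>2 - (norm (x - a))\<^sup>2) / 2"
    unfolding power2_norm_eq_inner using xy by (simp add: algebra_simps inner_commute)
  finally have "\<bar>field_poly G x a - field_poly G y a\<bar> =
      \<bar>m\<bar> * (\<bar>(norm (y - a))\<^sup>2 - (norm (x - a))\<^sup>2\<bar> / 2)"
    by (simp only: abs_mult abs_divide abs_numeral)
  also have "\<dots> \<le> \<bar>m\<bar> * (((norm (x - a))\<^sup>2 + (norm (y - a))\<^sup>2) / 2)"
    by (intro mult_left_mono divide_right_mono) (auto simp: abs_le_iff)
  finally show "\<bar>field_poly G x a - field_poly G y a\<bar>
      \<le> \<bar>m\<bar> / 2 * ((norm (x - a))\<^sup>2 + (norm (y - a))\<^sup>2)" by (simp add: algebra_simps)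
qed simp

text \<open>
  The polynomial at \<open>e\<close> is zero, so the polynomial at \<open>x\<close> is quadratically small near \<open>e\<close>. Its
  values at \<open>x\<close> and at distance \<open>norm (x - e)\<close> from \<open>x\<close> in the direction of its gradient bound the
  gradient.
\<close>

lemma gradient_bound_near_critical_zero:
  fixes G :: "'a::euclidean_space one_field"
  assumes G: "Gamma1 G UNIV \<le> ennreal K" "K \<ge> 0"
    and e: "fst (G e) = 0" "snd (G e) = 0" and "x \<noteq> e"
  shows "norm (snd (G x)) \<le> 3 * K * norm (x - e)"
proof (cases "snd (G x) = 0")
  case False
  define h where "h = norm (x - e)"
  define u where "u = (h / norm (snd (G x))) *\<^sub>R snd (G x)"
  have h: "h > 0" using assms(5) by (simp add: h_def)
  have nu: "norm u = h" using h False by (simp add: u_def)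
  have du: "snd (G x) \<bullet> u = norm (snd (G x)) * h"
    using False by (simp add: u_def flip: power2_norm_eq_inner) (simp add: power2_eq_square)
  have ineq: "\<bar>fst (G x) + snd (G x) \<bullet> v\<bar> \<le> K / 2 * ((norm v)\<^sup>2 + (norm (e - (x + v)))\<^sup>2)" for v
    using one_field_inequality[OF G, of x e "x + v"] assms(5) e by (simp add: field_poly_def)
  have "norm (e - (x + u)) \<le> norm (e - x) + norm u"
    by (metis diff_diff_add norm_triangle_ineq4)
  then have "norm (e - (x + u)) \<le> 2 * h" using nu by (simp add: h_def norm_minus_commute)
  then have "(norm (e - (x + u)))\<^sup>2 \<le> (2 * h)\<^sup>2" by (intro power_mono) auto
  then have "(norm u)\<^sup>2 + (norm (e - (x + u)))\<^sup>2 \<le> 5 * h\<^sup>2" using nu by (simp add: power_mult_distrib)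
  then have "K / 2 * ((norm u)\<^sup>2 + (norm (e - (x + u)))\<^sup>2) \<le> K / 2 * (5 * h\<^sup>2)"
    using G(2) by (intro mult_left_mono) auto
  with ineq[of u] have "fst (G x) + norm (snd (G x)) * h \<le> K / 2 * (5 * h\<^sup>2)"
    unfolding du by linarith
  moreover have "- fst (G x) \<le> K / 2 * h\<^sup>2"
    using ineq[of 0] by (simp add: h_def norm_minus_commute)
  ultimately have "norm (snd (G x)) * h \<le> (3 * K * h) * h"
    by (simp add: power2_eq_square algebra_simps)
  then show ?thesis using h by (simp add: h_def)
qed (use G in simp)

text \<open>
  An absolutely minimal radial extension of data that vanish with their gradient on the unit sphere
  has constant at most \<open>K / 3\<close> on the sphere of radius \<open>9/10\<close>, hence on the ball that it bounds.
  Together with the smallness of the values near the unit sphere this bounds the value at the centre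
  by less than \<open>K / 4\<close>: at radius \<open>4/5\<close> the values are at most \<open>K / 50\<close>, and from there to the
  centre they change by at most \<open>K / 6 * 16/25\<close>.
\<close>

lemma radial_field_not_AMLE:
  fixes G F :: "'a::euclidean_space one_field"
  assumes fin: "Gamma1 F \<Omega> < \<infinity>" and K: "K = enn2real (Gamma1 F \<Omega>)" "K > 0"
    and disj: "\<Omega> \<inter> cball 0 (9/10) = {}"
    and sphere: "sphere 0 1 \<subseteq> \<Omega>"
    and F0: "\<And>x. x \<in> sphere 0 1 \<Longrightarrow> F x = 0"
    and radial: "\<And>x y. norm x = norm y \<Longrightarrow> fst (G x) = fst (G y)"
    and centre: "\<bar>fst (G 0)\<bar> \<ge> K / 4"
  shows "\<not> is_AMLE F \<Omega> G UNIV"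
proof
  assume A: "is_AMLE F \<Omega> G UNIV"
  have "Gamma1 G UNIV = ennreal K"
    using A fin K by (simp add: is_AMLE_def is_MLE_def)
  then have G: "Gamma1 G UNIV \<le> ennreal K" "K \<ge> 0" using K by auto
  have zero: "fst (G e) = 0" "snd (G e) = 0" if "norm e = 1" for e
  proof -
    have same: "field_poly G e = field_poly F e"
      using A sphere that by (auto simp: is_AMLE_def is_MLE_def)
    have *: "fst (G e) + snd (G e) \<bullet> v = 0" for v
      using fun_cong[OF same, of "e + v"] F0[of e] that by (simp add: field_poly_def)
    show "fst (G e) = 0" using *[of 0] by simp
    then show "snd (G e) = 0" using *[of "snd (G e)"] by simp
  qed
  define b :: 'a where "b = (SOME i. i \<in> Basis)"
  have b: "norm b = 1" by (simp add: b_def SOME_Basis)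
  obtain m where m: "\<And>x. norm x = 9/10 \<Longrightarrow> snd (G x) = m *\<^sub>R x"
    using radial_gradient_on_sphere[OF G radial, of "9/10"] by blast
  have mK: "\<bar>m\<bar> \<le> K / 3"
  proof -
    let ?x = "(9/10) *\<^sub>R b"
    have d: "?x - b = (-1/10) *\<^sub>R b"
      using scaleR_left_diff_distrib[of "9/10" 1 b] by simp
    have "norm (snd (G ?x)) \<le> 3 * K * norm (?x - b)"
    proof (rule gradient_bound_near_critical_zero[OF G zero[OF b]])
      show "?x \<noteq> b" using d b by fastforce
    qed
    moreover have "norm (snd (G ?x)) = \<bar>m\<bar> * (9/10)" using m[of ?x] b by simp
    ultimately show ?thesis using b unfolding d by simp
  qed
  have "Gamma1 G (ball 0 (9/10)) = Gamma1 G (frontier (ball 0 (9/10)))"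
  proof -
    have "closure (ball 0 (9/10)) \<subseteq> UNIV - \<Omega>" using disj by (simp add: closure_ball) blast
    moreover have "ball (0::'a) (9/10) \<noteq> {}" by simp
    ultimately show ?thesis using A unfolding is_AMLE_def by (metis bounded_ball open_ball)
  qed
  also have "\<dots> \<le> ennreal \<bar>m\<bar>"
    using Gamma1_radial_sphere_le[OF radial m] by (simp add: frontier_ball)
  also have "\<dots> \<le> ennreal (K / 3)" using mK by (rule ennreal_leI)
  finally have V: "Gamma1 G (ball 0 (9/10)) \<le> ennreal (K / 3)" .
  let ?y = "(4/5) *\<^sub>R b"
  have "snd (G 0) \<bullet> ?y = 0"
    by (rule radial_gradient_orthogonal[OF G radial]) auto
  moreover have "b \<noteq> 0" using b by auto
  ultimately have "\<bar>fst (G 0) - fst (G ?y)\<bar> \<le> K / 6 * (16/25)"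
    using one_field_inequality[OF V, of 0 ?y ?y] K b
    by (simp add: field_poly_def power2_eq_square)
  moreover have "\<bar>fst (G ?y)\<bar> \<le> K / 2 * (1/25)"
  proof -
    have "?y = b + (-1/5) *\<^sub>R b"
      using scaleR_left_distrib[of 1 "-1/5" b] by simp
    then show ?thesis
      using taylor_inequality[OF G, of b "(-1/5) *\<^sub>R b"] zero[OF b] b
      by (simp add: power2_eq_square)
  qed
  ultimately show False using centre K by (simp add: abs_if split: if_splits)
qed

section \<open>Reduction of the lower to the upper function\<close>

text \<open>
  Changing the signs of the field and of \<open>\<sigma>\<close> leaves the points, hulls and cells of the construction
  unchanged and negates \<open>w_d\<close>.
\<close>

lemma w_tilde_minus: "w_tilde (-1) \<kappa> F = w_tilde 1 \<kappa> (\<lambda>x. - F x)"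
  by (simp add: w_tilde_def fun_eq_iff)

lemma w_d_minus: "w_d (-1) \<kappa> F p x = - w_d 1 \<kappa> (\<lambda>x. - F x) p x"
  by (simp add: w_d_def w_tilde_minus)

lemma w_dS_minus_eq: "w_dS_minus \<kappa> F S x = - w_dS_plus \<kappa> (\<lambda>x. - F x) S x"
proof -
  have "w_dS_minus \<kappa> F S x = (SUP p\<in>S. - ereal (w_d 1 \<kappa> (\<lambda>x. - F x) p x))"
    by (simp add: w_dS_minus_def w_d_minus)
  then show ?thesis by (simp only: ereal_SUP_uminus_eq w_dS_plus_def)
qed

lemma w_hat_minus: "w_hat (-1) \<kappa> F = w_hat 1 \<kappa> (\<lambda>x. - F x)"
  by (simp add: w_hat_def w_tilde_minus fun_eq_iff)

lemma w_H_minus: "w_H (-1) \<kappa> F = w_H 1 \<kappa> (\<lambda>x. - F x)"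
  by (simp add: w_H_def w_tilde_minus fun_eq_iff)

lemma w_E_minus: "w_E (-1) \<kappa> F = w_E 1 \<kappa> (\<lambda>x. - F x)"
  by (simp add: w_E_def w_d_minus fun_eq_iff)

lemma w_star_minus: "w_star (-1) \<kappa> F = w_star 1 \<kappa> (\<lambda>x. - F x)"
  by (simp add: w_star_def w_d_minus fun_eq_iff)

lemma w_C_minus: "w_C (-1) \<kappa> F = w_C 1 \<kappa> (\<lambda>x. - F x)"
  by (simp add: w_C_def w_E_minus w_H_minus fun_eq_iff)

lemma w_T_minus: "w_T (-1) \<kappa> F = w_T 1 \<kappa> (\<lambda>x. - F x)"
  by (simp add: w_T_def w_hat_minus w_star_minus fun_eq_iff)

lemma w_K_minus_eq: "w_K_minus \<kappa> F A = w_K_plus \<kappa> (\<lambda>x. - F x) A"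
  by (simp add: w_K_minus_def w_K_plus_def w_star_minus w_dS_minus_eq)

lemma wells_minus_eq:
  fixes F :: "'a::euclidean_space one_field"
  assumes "\<kappa> > 0" "finite A" "A \<noteq> {}"
  shows "wells_minus F A \<kappa> x = - wells_plus (\<lambda>x. - F x) A \<kappa> x"
proof -
  let ?F = "\<lambda>x. - F x"
  have cell: "real_of_ereal (w_dS_minus \<kappa> F S (w_C (-1) \<kappa> F S))
      - \<kappa> / 2 * (infdist x (w_H (-1) \<kappa> F S))\<^sup>2 + \<kappa> / 2 * (infdist x (w_E (-1) \<kappa> F S))\<^sup>2
      = - wells_cell_fun \<kappa> ?F S x" for S
    by (simp add: wells_cell_fun_def w_dS_minus_eq w_C_minus w_H_minus w_E_minus)
  have "wells_minus F A \<kappa> x =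
      (THE v. \<exists>S\<in>w_K_plus \<kappa> ?F A. x \<in> w_T 1 \<kappa> ?F A S \<and> v = - wells_cell_fun \<kappa> ?F S x)"
    unfolding wells_minus_def cell w_K_minus_eq w_T_minus ..
  also have "\<dots> = - wells_plus ?F A \<kappa> x"
  proof (rule the_equality)
    show "\<exists>S\<in>w_K_plus \<kappa> ?F A. x \<in> w_T 1 \<kappa> ?F A S \<and> - wells_plus ?F A \<kappa> x = - wells_cell_fun \<kappa> ?F S x"
      using wells_cells_cover[OF assms] wells_plus_eq_cell_fun[OF assms(1,2)] by metis
  next
    fix v assume "\<exists>S\<in>w_K_plus \<kappa> ?F A. x \<in> w_T 1 \<kappa> ?F A S \<and> v = - wells_cell_fun \<kappa> ?F S x"
    then show "v = - wells_plus ?F A \<kappa> x"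
      using wells_plus_eq_cell_fun[OF assms(1,2)] by metis
  qed
  finally show ?thesis .
qed

section \<open>Infimum over finite subsets and rotations\<close>

text \<open>
  Here \<open>\<kappa>\<close> is a parameter, so that \<open>- F\<close> can be used with the constant of \<open>F\<close>.
\<close>

definition wells_inf :: "real \<Rightarrow> 'a::euclidean_space one_field \<Rightarrow> 'a set \<Rightarrow> 'a \<Rightarrow> real" where
  "wells_inf \<kappa> F \<Omega> x = (INF P \<in> {P. P \<noteq> {} \<and> finite P \<and> P \<subseteq> \<Omega>}. wells_plus F P \<kappa> x)"

lemma wells_minus_gen_eq:
  fixes F :: "'a::euclidean_space one_field"
  assumes "enn2real (Gamma1 F \<Omega>) > 0"
  shows "wells_minus_gen F \<Omega> x = - wells_inf (enn2real (Gamma1 F \<Omega>)) (\<lambda>x. - F x) \<Omega> x"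
proof -
  let ?\<P> = "{P. P \<noteq> {} \<and> finite P \<and> P \<subseteq> \<Omega>}"
  have "wells_minus_gen F \<Omega> x =
      (SUP P\<in>?\<P>. - wells_plus (\<lambda>x. - F x) P (enn2real (Gamma1 F \<Omega>)) x)"
    unfolding wells_minus_gen_def using wells_minus_eq[OF assms] by (intro SUP_cong) auto
  then show ?thesis
    by (simp add: wells_inf_def Inf_real_def image_image)
qed

text \<open>
  Take \<open>z = x\<close> in the maximum that gives Wells' function of a finite set.
\<close>

lemma wells_inf_ge:
  fixes F :: "'a::euclidean_space one_field"
  assumes "\<kappa> > 0" "\<Omega> \<noteq> {}" "\<And>p. p \<in> \<Omega> \<Longrightarrow> c \<le> w_d 1 \<kappa> F p x"
  shows "c \<le> wells_inf \<kappa> F \<Omega> x"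
  unfolding wells_inf_def
proof (rule cINF_greatest)
  obtain p where "p \<in> \<Omega>" using assms(2) by blast
  then have "{p} \<in> {P. P \<noteq> {} \<and> finite P \<and> P \<subseteq> \<Omega>}" by auto
  then show "{P. P \<noteq> {} \<and> finite P \<and> P \<subseteq> \<Omega>} \<noteq> {}" by blast
next
  fix P assume "P \<in> {P. P \<noteq> {} \<and> finite P \<and> P \<subseteq> \<Omega>}"
  then have P: "P \<noteq> {}" "finite P" "P \<subseteq> \<Omega>" by auto
  have "c \<le> wells_env \<kappa> F P x x"
    using P assms(3) by (auto simp: wells_env_def)
  then show "c \<le> wells_plus F P \<kappa> x"
    using wells_plus_eq_max[OF assms(1) P(2,1)] by (metis order_trans)
qed

lemma wells_env_orthogonal:
  fixes F :: "'a::euclidean_space one_field"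
  assumes R: "orthogonal_transformation R"
    and eqv: "\<And>p. p \<in> A \<Longrightarrow> F (R p) = (fst (F p), R (snd (F p)))"
  shows "wells_env \<kappa> F (R ` A) (R x) (R z) = wells_env \<kappa> F A x z"
proof -
  have lin: "linear R" using R by (rule orthogonal_transformation_linear)
  have n: "norm (R v) = norm v" for v using R by (rule orthogonal_transformation_norm)
  have "w_d 1 \<kappa> F (R p) (R z) = w_d 1 \<kappa> F p z" if "p \<in> A" for p
  proof -
    have "R z - w_tilde 1 \<kappa> F (R p) = R (z - w_tilde 1 \<kappa> F p)"
      using eqv[OF that] by (simp add: w_tilde_def linear_diff[OF lin] linear_scale[OF lin])
    then show ?thesis using eqv[OF that] n by (simp add: w_d_def)
  qed
  then have "(\<lambda>p. w_d 1 \<kappa> F p (R z)) ` R ` A = (\<lambda>p. w_d 1 \<kappa> F p z) ` A"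
    unfolding image_image by (intro image_cong refl)
  moreover have "norm (R x - R z) = norm (x - z)"
    using n by (simp flip: linear_diff[OF lin])
  ultimately show ?thesis by (simp add: wells_env_def)
qed

lemma wells_plus_orthogonal:
  fixes F :: "'a::euclidean_space one_field"
  assumes "\<kappa> > 0" "finite A" "A \<noteq> {}" and R: "orthogonal_transformation R"
    and eqv: "\<And>p. p \<in> A \<Longrightarrow> F (R p) = (fst (F p), R (snd (F p)))"
  shows "wells_plus F (R ` A) \<kappa> (R x) = wells_plus F A \<kappa> x"
proof -
  have env: "wells_env \<kappa> F (R ` A) (R x) (R v) = wells_env \<kappa> F A x v" for v
    by (rule wells_env_orthogonal[OF R]) (rule eqv)
  obtain z where z: "wells_plus F A \<kappa> x = wells_env \<kappa> F A x z"
      "\<And>z'. wells_env \<kappa> F A x z' \<le> wells_env \<kappa> F A x z"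
    using wells_plus_eq_max[OF assms(1-3)] by blast
  obtain y where y: "wells_plus F (R ` A) \<kappa> (R x) = wells_env \<kappa> F (R ` A) (R x) y"
      "\<And>z'. wells_env \<kappa> F (R ` A) (R x) z' \<le> wells_env \<kappa> F (R ` A) (R x) y"
    using wells_plus_eq_max[of \<kappa> "R ` A"] assms(1-3) by blast
  obtain u where u: "y = R u"
    using orthogonal_transformation_surj[OF R] by (metis surjD)
  show ?thesis
    using y(2)[of "R z"] z(2)[of u] unfolding y(1) z(1) u env by simp
qed

text \<open>
  Rotations permute the finite subsets of a radial set, and Wells' function of a finite set is
  equivariant because the maximum describing it is.
\<close>

lemma wells_inf_radial:
  fixes F :: "(real ^ 'n) one_field"
  assumes "\<kappa> > 0"
    and inv: "\<And>p q. p \<in> \<Omega> \<Longrightarrow> norm q = norm p \<Longrightarrow> q \<in> \<Omega> \<and> fst (F q) = fst (F p)"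
    and crit: "\<And>p. p \<in> \<Omega> \<Longrightarrow> snd (F p) = 0"
    and "norm x = norm y"
  shows "wells_inf \<kappa> F \<Omega> x = wells_inf \<kappa> F \<Omega> y"
proof -
  let ?\<P> = "{P. P \<noteq> {} \<and> finite P \<and> P \<subseteq> \<Omega>}"
  obtain R where R: "orthogonal_transformation R" "R x = y"
    using orthogonal_transformation_exists[OF assms(4)] by blast
  have n: "norm (R v) = norm v" for v using R(1) by (rule orthogonal_transformation_norm)
  have R0: "R 0 = 0" using R(1) by (simp add: orthogonal_transformation_linear linear_0)
  have mem: "R p \<in> \<Omega>" if "p \<in> \<Omega>" for p using inv[OF that n] by blast
  have pull: "\<exists>P'\<in>?\<P>. P = R ` P'" if "P \<in> ?\<P>" for P
  proof -
    have s: "surj R" using R(1) by (rule orthogonal_transformation_surj)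
    have "inv_into UNIV R q \<in> \<Omega>" if "q \<in> \<Omega>" for q
      using inv[OF that] n surj_f_inv_f[OF s] by metis
    then have "inv_into UNIV R ` P \<in> ?\<P>" using that by auto
    moreover have "P = R ` inv_into UNIV R ` P"
      using s by (simp add: image_image surj_f_inv_f)
    ultimately show ?thesis by blast
  qed
  have img: "(`) R ` ?\<P> = ?\<P>"
  proof
    show "(`) R ` ?\<P> \<subseteq> ?\<P>" using mem by auto
    show "?\<P> \<subseteq> (`) R ` ?\<P>"
    proof
      fix P assume "P \<in> ?\<P>"
      from pull[OF this] obtain P' where "P' \<in> ?\<P>" "P = R ` P'" by (elim bexE)
      then show "P \<in> (`) R ` ?\<P>" by (intro image_eqI)
    qed
  qed
  have eqv: "F (R p) = (fst (F p), R (snd (F p)))" if "p \<in> \<Omega>" for p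
    using inv[OF that n] crit[OF that] crit[OF mem[OF that]] R0 by (simp add: prod_eq_iff)
  have "wells_inf \<kappa> F \<Omega> y = (INF P\<in>(`) R ` ?\<P>. wells_plus F P \<kappa> (R x))"
    unfolding wells_inf_def img R(2) ..
  also have "\<dots> = (INF P\<in>?\<P>. wells_plus F (R ` P) \<kappa> (R x))"
    by (simp only: image_image)
  also have "\<dots> = wells_inf \<kappa> F \<Omega> x"
    unfolding wells_inf_def
  proof (intro INF_cong refl)
    fix P assume P: "P \<in> ?\<P>"
    show "wells_plus F (R ` P) \<kappa> (R x) = wells_plus F P \<kappa> x"
      by (rule wells_plus_orthogonal[OF assms(1) _ _ R(1)]) (use P eqv in auto)
  qed
  finally show ?thesis ..
qed

section \<open>The two circles\<close>

theorem proposition30: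
  fixes F :: "(real ^ 2) one_field" and \<Omega>1 \<Omega>2 \<Omega> :: "(real ^ 2) set"
  assumes "\<Omega>1 = sphere 0 1" and "\<Omega>2 = sphere 0 2" and "\<Omega> = \<Omega>1 \<union> \<Omega>2"
    and "F \<in> F1 \<Omega>"
    and "\<And>x. x \<in> \<Omega>1 \<Longrightarrow> fst (F x) = 0"
    and "\<And>x. x \<in> \<Omega>2 \<Longrightarrow> fst (F x) = 1"
    and "\<And>x. x \<in> \<Omega> \<Longrightarrow> snd (F x) = 0"
  shows "\<not> is_AMLE F \<Omega> (assoc_field (wells_plus_gen F \<Omega>)) UNIV \<and>
         \<not> is_AMLE F \<Omega> (assoc_field (wells_minus_gen F \<Omega>)) UNIV"
proof -
  define K where "K = enn2real (Gamma1 F \<Omega>)"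
  have fin: "Gamma1 F \<Omega> < \<infinity>" using assms(4) by (simp add: F1_def)
  then have \<Gamma>: "Gamma1 F \<Omega> \<le> ennreal K" by (simp add: K_def)
  have mem: "p \<in> \<Omega> \<longleftrightarrow> norm p = 1 \<or> norm p = 2" for p
    by (simp add: assms(1-3))
  have F_in: "fst (F p) = 0" "snd (F p) = 0" if "norm p = 1" for p
    using that assms(5,7) mem by (auto simp: assms(1))
  have F_out: "fst (F p) = 1" "snd (F p) = 0" if "norm p = 2" for p
    using that assms(6,7) mem by (auto simp: assms(2))
  \<comment> \<open>Compare the nearest points of the two circles, at their midpoint.\<close>
  have K4: "K \<ge> 4"
  proof -
    let ?e = "axis 1 1 :: real ^ 2"
    have n: "norm ?e = 1" "norm (2 *\<^sub>R ?e) = 2" by simp_all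
    have d: "?e - (3/2) *\<^sub>R ?e = (-1/2) *\<^sub>R ?e" "2 *\<^sub>R ?e - (3/2) *\<^sub>R ?e = (1/2) *\<^sub>R ?e"
      using scaleR_left_diff_distrib[of 1 "3/2" ?e] scaleR_left_diff_distrib[of 2 "3/2" ?e] by simp_all
    have "?e \<in> \<Omega>" "2 *\<^sub>R ?e \<in> \<Omega>" "?e \<noteq> 2 *\<^sub>R ?e"
      using n by (auto simp: mem simp del: norm_scaleR)
    then have "\<bar>field_poly F ?e ((3/2) *\<^sub>R ?e) - field_poly F (2 *\<^sub>R ?e) ((3/2) *\<^sub>R ?e)\<bar>
        \<le> K / 2 * ((norm (?e - (3/2) *\<^sub>R ?e))\<^sup>2 + (norm (2 *\<^sub>R ?e - (3/2) *\<^sub>R ?e))\<^sup>2)"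
      by (intro one_field_inequality[OF \<Gamma>]) (auto simp: K_def)
    then show ?thesis
      unfolding d field_poly_def F_in[OF n(1)] F_out[OF n(2)] by (simp add: power2_eq_square)
  qed
  \<comment> \<open>The sign \<open>s = -1\<close> is for the lower function, which is minus the upper function of \<open>- F\<close>.\<close>
  have not_AMLE: "\<not> is_AMLE F \<Omega> G UNIV"
    if s: "\<bar>s\<bar> = 1" and H: "\<And>p. H p = s *\<^sub>R F p"
      and G: "\<And>x. fst (G x) = s * wells_inf K H \<Omega> x" for G H s
  proof (rule radial_field_not_AMLE[OF fin K_def])
    show "K > 0" using K4 by simp
    show "\<Omega> \<inter> cball 0 (9/10) = {}" by (auto simp: mem)
    show "sphere 0 1 \<subseteq> \<Omega>" by (auto simp: mem)
    show "F x = 0" if "x \<in> sphere 0 1" for x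
      using F_in[of x] that by (simp add: prod_eq_iff)
    have inv: "q \<in> \<Omega> \<and> fst (H q) = fst (H p)" if "p \<in> \<Omega>" "norm q = norm p" for p q
      using that F_in(1) F_out(1) unfolding mem H by auto
    have crit: "snd (H p) = 0" if "p \<in> \<Omega>" for p
      using assms(7)[OF that] by (simp add: H)
    show "fst (G x) = fst (G y)" if "norm x = norm y" for x y
      unfolding G using wells_inf_radial[OF \<open>K > 0\<close> inv crit that] by simp
    have "K / 4 \<le> wells_inf K H \<Omega> 0"
    proof (rule wells_inf_ge[OF \<open>K > 0\<close>])
      show "\<Omega> \<noteq> {}" using mem vector_choose_size[of 1] by auto
      show "K / 4 \<le> w_d 1 K H p 0" if "p \<in> \<Omega>" for p
      proof -
        have "w_d 1 K H p 0 = s * fst (F p) + K / 4 * (norm p)\<^sup>2"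
          using assms(7)[OF that] by (simp add: w_d_def w_tilde_def H)
        then show ?thesis
          using that s K4 F_in(1)[of p] F_out(1)[of p] unfolding mem by auto
      qed
    qed
    then show "K / 4 \<le> \<bar>fst (G 0)\<bar>" by (simp add: G abs_mult s)
  qed
  have "\<not> is_AMLE F \<Omega> (assoc_field (wells_plus_gen F \<Omega>)) UNIV"
    by (rule not_AMLE[of 1 F])
      (simp_all add: assoc_field_def wells_plus_gen_def wells_inf_def K_def)
  moreover have "\<not> is_AMLE F \<Omega> (assoc_field (wells_minus_gen F \<Omega>)) UNIV"
    using K4 by (intro not_AMLE[of "-1" "\<lambda>x. - F x"])
      (simp_all add: assoc_field_def wells_minus_gen_eq K_def)
  ultimately show ?thesis ..
qed

end
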